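(* Let $(X,A,B,p,q,k,s)$ be a semibiproduct of semigroups. For every semigroup $Z$ and every semigroup homomorphism $f\colon A\to Z$ with $f=fsp$, there exists a unique semigroup homomorphism $\bar f\colon B\to Z$ such that $f=\bar f p$.
   Context: A semibiproduct of semigroups $(X,A,B,p,q,k,s)$ consists of semigroups $X,A,B$ (written additively, not necessarily commutative), semigroup homomorphisms $k\colon X\to A$ and $p\colon A\to B$, and set-theoretical maps $q\colon A\to X$ and $s\colon B\to A$ (not required to be homomorphisms), such that $kq(a)+sp(a)=a$ for all $a\in A$, $ps=1_B$ and $qk=1_X$. Composition of maps is written by juxtaposition, so $fsp=f\circ s\circ p$. *)

theory Defs
  imports Main
begin

text \<open>
  A semigroup is a type of class \<open>semigroup_add\<close>, whose addition is associative
  but need not be commutative. A map between semigroups is a homomorphism only where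
  this is stated explicitly.
\<close>

definition semigroup_hom :: "('a::semigroup_add \<Rightarrow> 'b::semigroup_add) \<Rightarrow> bool"
  where "semigroup_hom f \<longleftrightarrow> (\<forall>x y. f (x + y) = f x + f y)"

locale semibiproduct =
  fixes p :: "'a::semigroup_add \<Rightarrow> 'b::semigroup_add"
    and q :: "'a \<Rightarrow> 'x::semigroup_add"
    and k :: "'x \<Rightarrow> 'a"
    and s :: "'b \<Rightarrow> 'a"
  assumes hom_k: "semigroup_hom k"
    and hom_p: "semigroup_hom p"
    and decomp: "k (q a) + s (p a) = a"
    and p_s: "p \<circ> s = id"
    and q_k: "q \<circ> k = id"

end

theory Submission
  imports Defs
begin

text \<open>Since \<open>p \<circ> s = id\<close>, composing \<open>f = g \<circ> p\<close> with
  \<open>s\<close> forces \<open>g = f \<circ> s\<close>. Although \<open>s\<close> need not be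
  additive, \<open>s (x + y)\<close> and \<open>s x + s y\<close> have the same image under
  \<open>p\<close>, and \<open>f = f \<circ> s \<circ> p\<close> says that \<open>f\<close> depends
  only on that image; hence \<open>f \<circ> s\<close> is additive.\<close>

theorem proposition4:
  fixes p :: "'a::semigroup_add \<Rightarrow> 'b::semigroup_add"
    and q :: "'a \<Rightarrow> 'x::semigroup_add"
    and k :: "'x \<Rightarrow> 'a"
    and s :: "'b \<Rightarrow> 'a"
    and f :: "'a \<Rightarrow> 'z::semigroup_add"
  assumes "semibiproduct p q k s"
    and "semigroup_hom f"
    and "f = f \<circ> s \<circ> p"
  shows "\<exists>!g :: 'b \<Rightarrow> 'z. semigroup_hom g \<and> f = g \<circ> p"
proof (rule ex1I[of _ "f \<circ> s"], intro conjI)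
  interpret semibiproduct p q k s by (fact assms(1))
  have ps: "p (s b) = b" for b
    using p_s by (metis comp_apply id_apply)
  have fsp: "f (s (p a)) = f a" for a
    using assms(3) by (metis comp_apply)
  have "f (s (x + y)) = f (s x) + f (s y)" for x y
  proof -
    \<comment> \<open>Rewriting \<open>x + y\<close> as the image of \<open>s x + s y\<close> puts
      \<open>s \<circ> p\<close> under \<open>f\<close>, where \<open>fsp\<close> removes
      it.\<close>
    have "f (s (x + y)) = f (s (p (s x + s y)))"
      using hom_p by (simp add: semigroup_hom_def ps)
    also have "\<dots> = f (s x) + f (s y)"
      using assms(2) by (simp add: fsp semigroup_hom_def)
    finally show ?thesis .
  qed
  then show "semigroup_hom (f \<circ> s)"
    by (simp add: semigroup_hom_def)
  show "f = f \<circ> s \<circ> p" by (fact assms(3))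
  \<comment> \<open>Pointwise, \<open>f (s b) = g (p (s b)) = g b\<close>.\<close>
  show "g = f \<circ> s" if "semigroup_hom g \<and> f = g \<circ> p" for g
    using that by (simp add: fun_eq_iff ps)
qed

end
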